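(* Let $n\in\{0,\dots,N-1\}$. If for every element $K\in\mathcal T_h$ the numbers $\omega^K_{E_{\nu\mu}}=-(\nabla\psi_{k_\mu},\nabla\psi_{k_\nu})_K$ satisfy $$\omega^K_{E_{\nu\mu}}>0,\qquad \nu<\mu,\ \nu,\mu\in\{1,2,3,4\},$$ then for $P^{n+1}\in\mathbb R^{2n_h}$ the matrices $\tilde A_{n+1}(P^{n+1})$ and $A_{n+1}(P^{n+1})=\mathbf M+\tau\tilde A_{n+1}(P^{n+1})$ of the edge-averaged finite element (EAFE) scheme are both column M-matrices.
   Context: Column M-matrix: a real square matrix $A$ such that $A^T$ is a (nonsingular) M-matrix; in particular its off-diagonal entries are $\le 0$, it is invertible and its inverse is entrywise nonnegative. Setting. $\Omega\subset\mathbb R^3$ is a bounded Lipschitz (polyhedral) domain and $\mathcal T_h$ a conforming partition of $\Omega$ into tetrahedra. $V_h$ is the space of continuous functions that are affine on each $K\in\mathcal T_h$ and vanish on $\partial\Omega$; $\psi_1,\dots,\psi_{n_h}$ is its nodal basis (one function per interior node). $(\cdot,\cdot)$ is the $L^2(\Omega)$ inner product and $(\cdot,\cdot)_K$ the $L^2(K)$ one. $|\Omega_k|$ is the volume of $\Omega_k=\mathrm{supp}(\psi_k)$. $q^1,q^2$ are real constants (charges); $\tau>0$ is the time step for time levels $t^0<t^1<\dots<t^N=T$; $f$ is a given source function, $f^{n}=f(t^{n},\cdot)$. Matrices and vectors. $G_\Phi^{n}=((f^{n},\psi_1),\dots,(f^{n},\psi_{n_h}))^T$; $M=\frac14\mathrm{diag}(|\Omega_1|,\dots,|\Omega_{n_h}|)$;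 $\mathbf M=\mathrm{diag}(M,M)$; $\bar M=-(q^1M,\,q^2M)$ (size $n_h\times 2n_h$); $A_L=((\nabla\psi_j,\nabla\psi_k))_{k,j=1}^{n_h}$. For $P\in\mathbb R^{2n_h}$ put $\Phi^{n}(P)=A_L^{-1}(G_\Phi^{n}-\bar M P)\in\mathbb R^{n_h}$ and let $\phi_h=\sum_k\Phi^{n}(P)_k\psi_k$. EAFE stiffness matrix. For a tetrahedron $K$ with vertices $q_1,\dots,q_4$ (global node numbers $k_1,\dots,k_4$), let $\psi_{k_\nu}$ be the nodal (barycentric) functions on $K$ (also for boundary vertices), $E_{\nu\mu}$ the edge joining $q_\nu,q_\mu$, $\omega^K_{E_{\nu\mu}}=-(\nabla\psi_{k_\mu},\nabla\psi_{k_\nu})_K$ (symmetric in $\nu,\mu$), and $\tilde\alpha^{K,i}_{E_{\nu\mu}}=\Big[\frac1{|E_{\nu\mu}|}\int_{E_{\nu\mu}}e^{q^i\phi_h}\,ds\Big]^{-1}$. The $4\times4$ element matrix $\tilde A^{i,K}_n(P)$, $i=1,2$, has entries $$\tilde a^{i,K}_{\nu\mu}=-\omega^K_{E_{\nu\mu}}\tilde\alpha^{K,i}_{E_{\nu\mu}}e^{q^i\phi_h(q_\mu)}\ (\nu\ne\mu),\qquad \tilde a^{i,K}_{\mu\mu}=\sum_{k\neq\mu}\omega^K_{E_{k\mu}}\tilde\alpha^{K,i}_{E_{k\mu}}e^{q^i\phi_h(q_\mu)}.$$ $\tilde A^i_n(P)\in\mathbb R^{n_h\times n_h}$ is assembled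 from the $\tilde A^{i,K}_n(P)$ over all $K$, keeping only rows and columns of interior nodes (homogeneous Dirichlet condition), and $\tilde A_n(P)=\mathrm{diag}(\tilde A^1_n(P),\tilde A^2_n(P))$, $A_n(P)=\mathbf M+\tau\tilde A_n(P)$. *)

theory Defs
  imports "HOL-Analysis.Analysis" "Jordan_Normal_Form.Gauss_Jordan_Elimination"
begin

section \<open>M-matrices\<close>

definition M_matrix :: "real mat \<Rightarrow> bool" where
  "M_matrix A \<longleftrightarrow>
     square_mat A \<and>
     (\<forall>i<dim_row A. \<forall>j<dim_col A. i \<noteq> j \<longrightarrow> A $$ (i, j) \<le> 0) \<and>
     (\<exists>B. inverts_mat A B \<and> inverts_mat B A \<and>
          (\<forall>i<dim_row B. \<forall>j<dim_col B. 0 \<le> B $$ (i, j)))"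

definition column_M_matrix :: "real mat \<Rightarrow> bool" where
  "column_M_matrix A \<longleftrightarrow> M_matrix (transpose_mat A)"


section \<open>Domain, mesh and finite element space\<close>

text \<open>Near each boundary point \<open>\<Omega>\<close> is the strict epigraph, in the direction of some unit vector \<open>e\<close>,
  of a Lipschitz function on the hyperplane orthogonal to \<open>e\<close>.\<close>

definition lipschitz_domain :: "(real^3) set \<Rightarrow> bool" where
  "lipschitz_domain \<Omega> \<longleftrightarrow>
     open \<Omega> \<and> connected \<Omega> \<and> \<Omega> \<noteq> {} \<and>
     (\<forall>z \<in> frontier \<Omega>. \<exists>e L \<gamma> r. norm e = 1 \<and> L-lipschitz_on {y. inner e y = 0} \<gamma> \<and> 0 < r \<and>
        (\<forall>y \<in> ball z r. y \<in> \<Omega> \<longleftrightarrow> \<gamma> (y - inner e y *\<^sub>R e) < inner e y))"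

definition tetrahedral_mesh :: "(real^3) set \<Rightarrow> (real^3) set set \<Rightarrow> bool" where
  "tetrahedral_mesh \<Omega> \<T> \<longleftrightarrow> triangulation \<T> \<and> (\<forall>K\<in>\<T>. 3 simplex K) \<and> \<Union>\<T> = closure \<Omega>"

definition vertices :: "(real^3) set \<Rightarrow> (real^3) set" where
  "vertices K = {v. v extreme_point_of K}"

definition mesh_nodes :: "(real^3) set set \<Rightarrow> (real^3) set" where
  "mesh_nodes \<T> = (\<Union>K\<in>\<T>. vertices K)"

text \<open>Functions on \<open>\<Omega>\<close> are total functions whose values outside \<open>closure \<Omega>\<close> are irrelevant.\<close>

definition P1_space :: "(real^3) set set \<Rightarrow> (real^3 \<Rightarrow> real) set" where
  "P1_space \<T> =
     {v. continuous_on (\<Union>\<T>) v \<and> (\<forall>K\<in>\<T>. \<exists>a b. \<forall>y\<in>K. v y = inner a y + b)}"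

definition V_h :: "(real^3) set \<Rightarrow> (real^3) set set \<Rightarrow> (real^3 \<Rightarrow> real) set" where
  "V_h \<Omega> \<T> = {v \<in> P1_space \<T>. \<forall>y\<in>frontier \<Omega>. v y = 0}"

text \<open>Global node numbers are \<open>0, \<dots>, n_all - 1\<close>, the interior nodes being \<open>0, \<dots>, n_int - 1\<close>;
  \<open>glob K \<nu>\<close> is the global number of the local vertex \<open>\<nu> \<in> {0, 1, 2, 3}\<close> of the tetrahedron \<open>K\<close>.\<close>

record fe_data =
  dom :: "(real^3) set"
  elems :: "(real^3) set set"
  n_int :: nat
  n_all :: nat
  node :: "nat \<Rightarrow> real^3"
  glob :: "(real^3) set \<Rightarrow> nat \<Rightarrow> nat"
  psi :: "nat \<Rightarrow> real^3 \<Rightarrow> real"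

definition node_numbering :: "fe_data \<Rightarrow> bool" where
  "node_numbering S \<longleftrightarrow>
     n_int S \<le> n_all S \<and>
     bij_betw (node S) {..<n_all S} (mesh_nodes (elems S)) \<and>
     bij_betw (node S) {..<n_int S} (mesh_nodes (elems S) \<inter> dom S) \<and>
     (\<forall>K\<in>elems S. glob S K ` {..<4} \<subseteq> {..<n_all S} \<and>
        bij_betw (\<lambda>\<nu>. node S (glob S K \<nu>)) {..<4} (vertices K))"

definition nodal_basis :: "fe_data \<Rightarrow> bool" where
  "nodal_basis S \<longleftrightarrow>
     (\<forall>k<n_int S. psi S k \<in> V_h (dom S) (elems S)) \<and>
     (\<forall>k<n_all S. psi S k \<in> P1_space (elems S) \<and>
        (\<forall>j<n_all S. psi S k (node S j) = (if j = k then 1 else 0)))"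

definition fe_discretization :: "fe_data \<Rightarrow> bool" where
  "fe_discretization S \<longleftrightarrow>
     lipschitz_domain (dom S) \<and> bounded (dom S) \<and>
     tetrahedral_mesh (dom S) (elems S) \<and> node_numbering S \<and> nodal_basis S"


section \<open>Inner products and coefficient matrices\<close>

text \<open>Piecewise affine functions have a gradient off the element boundaries, a Lebesgue null set, so the
  unspecified value of \<open>grad\<close> there does not affect the integrals below.\<close>

definition grad :: "(real^3 \<Rightarrow> real) \<Rightarrow> real^3 \<Rightarrow> real^3" where
  "grad v y = (THE D. GDERIV v y :> D)"

definition L2_inner :: "(real^3) set \<Rightarrow> (real^3 \<Rightarrow> real) \<Rightarrow> (real^3 \<Rightarrow> real) \<Rightarrow> real" where
  "L2_inner D u v = (LINT y:D|lebesgue. u y * v y)"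

definition L2_inner_vec :: "(real^3) set \<Rightarrow> (real^3 \<Rightarrow> real^3) \<Rightarrow> (real^3 \<Rightarrow> real^3) \<Rightarrow> real" where
  "L2_inner_vec D u v = (LINT y:D|lebesgue. inner (u y) (v y))"

definition support_volume :: "fe_data \<Rightarrow> nat \<Rightarrow> real" where
  "support_volume S k = measure lebesgue (closure {y \<in> dom S. psi S k y \<noteq> 0})"

definition G_vec :: "fe_data \<Rightarrow> (real^3 \<Rightarrow> real) \<Rightarrow> real vec" where
  "G_vec S fn = Matrix.vec (n_int S) (\<lambda>k. L2_inner (dom S) fn (psi S k))"

definition mass_mat :: "fe_data \<Rightarrow> real mat" where
  "mass_mat S = (1/4) \<cdot>\<^sub>m mat_diag (n_int S) (support_volume S)"

definition block_mass_mat :: "fe_data \<Rightarrow> real mat" where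
  "block_mass_mat S = diag_block_mat [mass_mat S, mass_mat S]"

definition Mbar_mat :: "fe_data \<Rightarrow> real \<Rightarrow> real \<Rightarrow> real mat" where
  "Mbar_mat S q1 q2 =
     - Matrix.mat (n_int S) (2 * n_int S)
         (\<lambda>(k, j). if j < n_int S then q1 * mass_mat S $$ (k, j)
                   else q2 * mass_mat S $$ (k, j - n_int S))"

definition laplace_mat :: "fe_data \<Rightarrow> real mat" where
  "laplace_mat S =
     Matrix.mat (n_int S) (n_int S)
       (\<lambda>(k, j). L2_inner_vec (dom S) (grad (psi S j)) (grad (psi S k)))"

definition Phi_vec ::
  "fe_data \<Rightarrow> real \<Rightarrow> real \<Rightarrow> (real^3 \<Rightarrow> real) \<Rightarrow> real vec \<Rightarrow> real vec" where
  "Phi_vec S q1 q2 fn P =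
     the (mat_inverse (laplace_mat S)) *\<^sub>v (G_vec S fn - Mbar_mat S q1 q2 *\<^sub>v P)"

definition phi_h ::
  "fe_data \<Rightarrow> real \<Rightarrow> real \<Rightarrow> (real^3 \<Rightarrow> real) \<Rightarrow> real vec \<Rightarrow> real^3 \<Rightarrow> real" where
  "phi_h S q1 q2 fn P y = (\<Sum>k<n_int S. vec_index (Phi_vec S q1 q2 fn P) k * psi S k y)"


section \<open>The EAFE stiffness matrix\<close>

definition omega :: "fe_data \<Rightarrow> (real^3) set \<Rightarrow> nat \<Rightarrow> nat \<Rightarrow> real" where
  "omega S K \<nu> \<mu> =
     - L2_inner_vec K (grad (psi S (glob S K \<mu>))) (grad (psi S (glob S K \<nu>)))"

text \<open>Line integral over the segment from \<open>a\<close> to \<open>b\<close>, \<open>a \<noteq> b\<close>, with respect to arc length \<open>s\<close>.\<close>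

definition edge_integral :: "(real^3 \<Rightarrow> real) \<Rightarrow> real^3 \<Rightarrow> real^3 \<Rightarrow> real" where
  "edge_integral g a b = integral {0..dist a b} (\<lambda>s. g (a + (s / dist a b) *\<^sub>R (b - a)))"

definition local_vertex :: "fe_data \<Rightarrow> (real^3) set \<Rightarrow> nat \<Rightarrow> real^3" where
  "local_vertex S K \<nu> = node S (glob S K \<nu>)"

definition eafe_alpha ::
  "fe_data \<Rightarrow> real \<Rightarrow> (real^3 \<Rightarrow> real) \<Rightarrow> (real^3) set \<Rightarrow> nat \<Rightarrow> nat \<Rightarrow> real" where
  "eafe_alpha S q \<phi> K \<nu> \<mu> =
     (let a = local_vertex S K \<nu>; b = local_vertex S K \<mu>
      in inverse (1 / dist a b * edge_integral (\<lambda>y. exp (q * \<phi> y)) a b))"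

definition eafe_elem_mat ::
  "fe_data \<Rightarrow> real \<Rightarrow> (real^3 \<Rightarrow> real) \<Rightarrow> (real^3) set \<Rightarrow> real mat" where
  "eafe_elem_mat S q \<phi> K =
     Matrix.mat 4 4 (\<lambda>(\<nu>, \<mu>).
       if \<nu> \<noteq> \<mu> then
         - omega S K \<nu> \<mu> * eafe_alpha S q \<phi> K \<nu> \<mu> * exp (q * \<phi> (local_vertex S K \<mu>))
       else
         (\<Sum>k\<in>{..<4} - {\<mu>}.
            omega S K k \<mu> * eafe_alpha S q \<phi> K k \<mu> * exp (q * \<phi> (local_vertex S K \<mu>))))"

definition eafe_mat :: "fe_data \<Rightarrow> real \<Rightarrow> (real^3 \<Rightarrow> real) \<Rightarrow> real mat" where
  "eafe_mat S q \<phi> =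
     Matrix.mat (n_int S) (n_int S) (\<lambda>(i, j).
       \<Sum>K\<in>elems S. \<Sum>\<nu><4. \<Sum>\<mu><4.
         if glob S K \<nu> = i \<and> glob S K \<mu> = j then eafe_elem_mat S q \<phi> K $$ (\<nu>, \<mu>) else 0)"

definition A_tilde ::
  "fe_data \<Rightarrow> real \<Rightarrow> real \<Rightarrow> (real^3 \<Rightarrow> real) \<Rightarrow> real vec \<Rightarrow> real mat" where
  "A_tilde S q1 q2 fn P =
     diag_block_mat [eafe_mat S q1 (phi_h S q1 q2 fn P), eafe_mat S q2 (phi_h S q1 q2 fn P)]"

definition A_mat ::
  "fe_data \<Rightarrow> real \<Rightarrow> real \<Rightarrow> real \<Rightarrow> (real^3 \<Rightarrow> real) \<Rightarrow> real vec \<Rightarrow> real mat" where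
  "A_mat S q1 q2 \<tau> fn P = block_mass_mat S + \<tau> \<cdot>\<^sub>m A_tilde S q1 q2 fn P"

end

theory Submission
  imports Defs "Jordan_Normal_Form.Determinant"
begin

text \<open>All edge averages are positive, so every off-diagonal entry of an element matrix is negative,
  while its columns sum to zero. After assembly, the column sums over a set \<open>J\<close> of interior nodes are
  thus nonnegative for columns in \<open>J\<close>, and positive for a column whose node shares an element with a
  node outside \<open>J\<close>, possibly on the boundary. Connectedness of the domain yields such an element for
  every nonempty \<open>J\<close>, since a farthest point of the closure from the origin is a boundary node. This chained
  diagonal dominance gives a nonnegative inverse by a minimum principle, and the nonnegative diagonal
  matrix of lumped masses does not disturb it.\<close>

section \<open>M-matrices\<close>

text \<open>If \<open>x\<close> has a negative minimum, attained on the index set \<open>J\<close>, then for a column \<open>j \<in> J\<close> whose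
  sum over \<open>J\<close> is positive the \<open>j\<close>-th entry of the transposed product is negative.\<close>

lemma transpose_nonneg_imp_nonneg:
  fixes a :: "nat \<Rightarrow> nat \<Rightarrow> real" and x :: "nat \<Rightarrow> real"
  assumes off: "\<And>i j. i < n \<Longrightarrow> j < n \<Longrightarrow> i \<noteq> j \<Longrightarrow> a i j \<le> 0"
    and col: "\<And>j. j < n \<Longrightarrow> 0 \<le> (\<Sum>i<n. a i j)"
    and chain: "\<And>J. J \<subseteq> {..<n} \<Longrightarrow> J \<noteq> {} \<Longrightarrow> \<exists>j\<in>J. 0 < (\<Sum>i\<in>J. a i j)"
    and x: "\<And>j. j < n \<Longrightarrow> 0 \<le> (\<Sum>i<n. a i j * x i)"
    and k: "k < n"
  shows "0 \<le> x k"
proof (rule ccontr)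
  assume neg: "\<not> 0 \<le> x k"
  define m where "m = Min (x ` {..<n})"
  have m_le: "m \<le> x i" if "i < n" for i
    unfolding m_def using that by auto
  have m: "m < 0"
    using m_le[OF k] neg by linarith
  define J where "J = {i. i < n \<and> x i = m}"
  have "m \<in> x ` {..<n}"
    unfolding m_def using k by (intro Min_in) auto
  then have "J \<noteq> {}" and J: "J \<subseteq> {..<n}"
    unfolding J_def by auto
  then obtain j where j: "j \<in> J" and pos: "0 < (\<Sum>i\<in>J. a i j)"
    using chain by blast
  then have jn: "j < n" and xj: "x j = m"
    by (auto simp: J_def)
  have s: "a i j * (x i - m) \<le> 0" if "i < n" for i
    using off[OF that jn] m_le[OF that] xj by (cases "i = j") (auto intro: mult_nonpos_nonneg)
  \<comment> \<open>Measured from the minimum, the \<open>j\<close>-th entry is a sum of two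
    nonpositive parts; being nonnegative, it forces both to vanish.\<close>
  have split: "(\<Sum>i<n. a i j * x i) = (\<Sum>i<n. a i j * (x i - m)) + m * (\<Sum>i<n. a i j)"
    by (simp add: algebra_simps sum.distrib sum_subtractf sum_distrib_left)
  have "(\<Sum>i<n. a i j * (x i - m)) \<le> 0"
    using s by (intro sum_nonpos) auto
  moreover have mcol: "m * (\<Sum>i<n. a i j) \<le> 0"
    using m col[OF jn] by (intro mult_nonpos_nonneg) auto
  ultimately have "(\<Sum>i<n. a i j * (x i - m)) = 0" and "m * (\<Sum>i<n. a i j) = 0"
    using x[OF jn] split by linarith+
  then have s0: "(\<Sum>i<n. - (a i j * (x i - m))) = 0" and col0: "(\<Sum>i<n. a i j) = 0"
    using m by (auto simp: sum_negf)
  have "\<forall>i\<in>{..<n}. - (a i j * (x i - m)) = 0"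
    using s0 s by (subst (asm) sum_nonneg_eq_0_iff) auto
  \<comment> \<open>Off \<open>J\<close> the factor \<open>x i - m\<close> is positive. Column
    \<open>j\<close> is thus supported on \<open>J\<close>, so its sum over \<open>J\<close> is the
    full column sum, which is zero.\<close>
  then have "\<forall>i\<in>{..<n} - J. a i j = 0"
    by (auto simp: J_def)
  then have "(\<Sum>i\<in>J. a i j) = (\<Sum>i<n. a i j)"
    using J by (intro sum.mono_neutral_left) auto
  with col0 pos show False
    by simp
qed

text \<open>The minimum principle is used twice: applied to a kernel vector and to its negative it
  shows invertibility, applied to the columns of the inverse it shows their nonnegativity.\<close>

lemma column_M_matrixI:
  assumes A: "A \<in> carrier_mat n n"
    and off: "\<And>i j. i < n \<Longrightarrow> j < n \<Longrightarrow> i \<noteq> j \<Longrightarrow> A $$ (i, j) \<le> 0"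
    and col: "\<And>j. j < n \<Longrightarrow> 0 \<le> (\<Sum>i<n. A $$ (i, j))"
    and chain: "\<And>J. J \<subseteq> {..<n} \<Longrightarrow> J \<noteq> {} \<Longrightarrow> \<exists>j\<in>J. 0 < (\<Sum>i\<in>J. A $$ (i, j))"
  shows "column_M_matrix A"
proof -
  have mult: "vec_index (transpose_mat A *\<^sub>v v) j = (\<Sum>i<n. A $$ (i, j) * vec_index v i)"
    if "v \<in> carrier_vec n" "j < n" for v j
    using A that by (auto simp: scalar_prod_def lessThan_atLeast0)
  have mono: "0 \<le> vec_index v k"
    if v: "v \<in> carrier_vec n" and nn: "\<And>j. j < n \<Longrightarrow> 0 \<le> vec_index (transpose_mat A *\<^sub>v v) j"
      and k: "k < n" for v k
    using transpose_nonneg_imp_nonneg[of n "\<lambda>i j. A $$ (i, j)" "vec_index v" k, OF off col chain _ k]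
      nn mult[OF v] by simp
  have AT: "transpose_mat A \<in> carrier_mat n n"
    using A by auto
  have "det (transpose_mat A) \<noteq> 0"
  proof
    assume "det (transpose_mat A) = 0"
    then obtain v where v: "v \<in> carrier_vec n" "v \<noteq> 0\<^sub>v n" "transpose_mat A *\<^sub>v v = 0\<^sub>v n"
      using det_0_iff_vec_prod_zero_field[OF AT] by auto
    have "vec_index (transpose_mat A *\<^sub>v (- v)) j = 0" if "j < n" for j
    proof -
      have "vec_index (transpose_mat A *\<^sub>v (- v)) j = - vec_index (transpose_mat A *\<^sub>v v) j"
        using v(1) that by (subst (1 2) mult) (auto simp: sum_negf)
      with v(3) that show ?thesis
        by simp
    qed
    then have "0 \<le> vec_index (- v) k" if "k < n" for k
      using v(1) that by - (rule mono, auto)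
    moreover have "0 \<le> vec_index v k" if "k < n" for k
      using v(1,3) that by - (rule mono, auto)
    ultimately have "vec_index v k = 0" if "k < n" for k
      using v(1) that by fastforce
    then show False
      using v by auto
  qed
  then obtain B where B: "B \<in> carrier_mat n n" "transpose_mat A * B = 1\<^sub>m n" "B * transpose_mat A = 1\<^sub>m n"
    using det_non_zero_imp_unit[OF AT, where b = "()"] by (auto simp: Units_def ring_mat_def)
  have "0 \<le> B $$ (i, j)" if "i < n" "j < n" for i j
  proof -
    \<comment> \<open>Column \<open>j\<close> of the inverse solves the system whose right-hand side
      is a unit vector, hence nonnegative.\<close>
    have "transpose_mat A *\<^sub>v col B j = col (1\<^sub>m n) j"
      using col_mult2[OF AT B(1) that(2)] B(2) by simp
    then have "0 \<le> vec_index (col B j) i"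
      using that B(1) by - (rule mono, auto simp: unit_vec_def)
    then show ?thesis
      using that B(1) by simp
  qed
  then show ?thesis
    using A B off unfolding column_M_matrix_def M_matrix_def inverts_mat_def
    by (auto intro!: exI[of _ B])
qed

section \<open>Block diagonal matrices\<close>

lemma M_matrix_four_block:
  assumes "M_matrix A" and "M_matrix D"
  shows "M_matrix (four_block_mat A (0\<^sub>m (dim_row A) (dim_col D)) (0\<^sub>m (dim_row D) (dim_col A)) D)"
proof -
  obtain n m where A: "A \<in> carrier_mat n n" and D: "D \<in> carrier_mat m m"
    using assms by (auto simp: M_matrix_def)
  \<comment> \<open>The inverse in \<open>M_matrix_def\<close> comes without dimensions; comparing
    column counts in the two identities recovers them.\<close>
  have inverse: "\<exists>B \<in> carrier_mat k k. X * B = 1\<^sub>m k \<and> B * X = 1\<^sub>m k \<and> (\<forall>i<k. \<forall>j<k. 0 \<le> B $$ (i, j))"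
    if X: "X \<in> carrier_mat k k" "M_matrix X" for X k
  proof -
    obtain B where B: "X * B = 1\<^sub>m (dim_row X)" "B * X = 1\<^sub>m (dim_row B)"
      "\<forall>i<dim_row B. \<forall>j<dim_col B. 0 \<le> B $$ (i, j)"
      using X(2) by (auto simp: M_matrix_def inverts_mat_def)
    have "dim_col B = k" "dim_row B = k"
      using arg_cong[OF B(1), of dim_col] arg_cong[OF B(2), of dim_col] X(1) by auto
    with B X(1) show ?thesis
      by (intro bexI[of _ B]) auto
  qed
  obtain A' where A': "A' \<in> carrier_mat n n" "A * A' = 1\<^sub>m n" "A' * A = 1\<^sub>m n"
      "\<forall>i<n. \<forall>j<n. 0 \<le> A' $$ (i, j)"
    using inverse[OF A assms(1)] by auto
  obtain D' where D': "D' \<in> carrier_mat m m" "D * D' = 1\<^sub>m m" "D' * D = 1\<^sub>m m"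
      "\<forall>i<m. \<forall>j<m. 0 \<le> D' $$ (i, j)"
    using inverse[OF D assms(2)] by auto
  let ?M = "four_block_mat A (0\<^sub>m n m) (0\<^sub>m m n) D"
  let ?B = "four_block_mat A' (0\<^sub>m n m) (0\<^sub>m m n) D'"
  have "?M * ?B = 1\<^sub>m (n + m)" "?B * ?M = 1\<^sub>m (n + m)"
    using A D A' D' by (subst mult_four_block_mat[where ?n1.0 = n and ?n2.0 = m]; auto)+
  moreover have "?M $$ (i, j) \<le> 0" if "i < n + m" "j < n + m" "i \<noteq> j" for i j
    using assms A D that by (auto simp: M_matrix_def)
  moreover have "0 \<le> ?B $$ (i, j)" if "i < n + m" "j < n + m" for i j
    using A' D' that by auto
  ultimately show ?thesis
    using A D A'(1) D'(1) unfolding M_matrix_def inverts_mat_def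
    by (auto intro!: exI[of _ ?B])
qed

lemma column_M_matrix_diag_block:
  assumes "\<forall>A\<in>set As. column_M_matrix A"
  shows "column_M_matrix (diag_block_mat As)"
  using assms
proof (induction As)
  case Nil
  \<comment> \<open>The empty list yields the 0 by 0 matrix, which is its own inverse.\<close>
  show ?case
    by (auto simp: column_M_matrix_def M_matrix_def inverts_mat_def intro!: exI[of _ "0\<^sub>m 0 0"])
next
  case (Cons A As)
  let ?D = "diag_block_mat As"
  have "M_matrix (transpose_mat A)" "M_matrix (transpose_mat ?D)"
    using Cons by (auto simp: column_M_matrix_def)
  from M_matrix_four_block[OF this] show ?case
    unfolding column_M_matrix_def diag_block_mat.simps Let_def
    by (subst transpose_four_block_mat) auto
qed

text \<open>Lets the masses and the scaled stiffness be combined separately for each charge.\<close>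

lemma diag_block_mat_add_smult:
  fixes A B C D :: "'a::semiring_0 mat"
  assumes "A \<in> carrier_mat n n" "B \<in> carrier_mat m m" "C \<in> carrier_mat n n" "D \<in> carrier_mat m m"
  shows "diag_block_mat [A, B] + a \<cdot>\<^sub>m diag_block_mat [C, D] =
    diag_block_mat [A + a \<cdot>\<^sub>m C, B + a \<cdot>\<^sub>m D]"
proof -
  have two: "diag_block_mat [X, Y] = four_block_mat X (0\<^sub>m n m) (0\<^sub>m m n) Y"
    if "X \<in> carrier_mat n n" "Y \<in> carrier_mat m m" for X Y :: "'a mat"
    unfolding diag_block_mat.simps(2)[of X "[Y]"] diag_block_mat_singleton Let_def using that by auto
  show ?thesis
    using assms
    by (simp add: two smult_four_block_mat[of _ n n _ m _ m] add_four_block_mat[of _ n n _ m _ m]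
        del: diag_block_mat.simps)
qed


section \<open>Nodes on the boundary\<close>

text \<open>An inner point of a segment is strictly closer to the origin than one of the
  endpoints.\<close>

lemma farthest_point_extreme:
  fixes x :: "'a::euclidean_space"
  assumes "x \<in> K" and "\<And>y. y \<in> K \<Longrightarrow> norm y \<le> norm x"
  shows "x extreme_point_of K"
  unfolding extreme_point_of_def
proof (intro conjI ballI notI)
  fix a b assume "a \<in> K" "b \<in> K" "x \<in> open_segment a b"
  then show False
    using dist_decreases_open_segment[of x a b 0] assms(2) by (fastforce simp: not_less)
qed (fact assms)

lemma open_contains_farther_point:
  fixes x :: "'a::euclidean_space"
  assumes "open \<Omega>" and "x \<in> \<Omega>"
  obtains y where "y \<in> \<Omega>" "norm x < norm y"
proof -
  obtain e where e: "e > 0" "cball x e \<subseteq> \<Omega>"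
    using assms open_contains_cball by blast
  show ?thesis
  proof (cases "x = 0")
    case True
    obtain d :: 'a where "norm d = e"
      using vector_choose_size[of e] e by auto
    with e True that[of d] show ?thesis
      by auto
  next
    case False
    \<comment> \<open>A step of length \<open>e\<close> away from the origin stays in the ball and
      raises the norm by exactly \<open>e\<close>; for \<open>x = 0\<close> any direction
      serves.\<close>
    let ?y = "x + (e / norm x) *\<^sub>R x"
    have "?y \<in> \<Omega>"
      using e False by (intro subsetD[OF e(2)]) (auto simp: dist_norm)
    moreover have "?y = (1 + e / norm x) *\<^sub>R x"
      by (simp add: algebra_simps)
    then have "norm ?y = (1 + e / norm x) * norm x"
      using e by simp
    then have "norm ?y = norm x + e"
      using False by (simp add: distrib_right)
    ultimately show ?thesis
      using that[of ?y] e by simp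
  qed
qed

lemma vertices_subset: "vertices K \<subseteq> K"
  by (auto simp: vertices_def extreme_point_of_def)

text \<open>A farthest point of the closure is extreme in any element containing it, hence a vertex;
  openness forbids it to lie in \<Omega>.\<close>

lemma mesh_node_not_interior:
  assumes mesh: "tetrahedral_mesh \<Omega> \<T>" and "open \<Omega>" "bounded \<Omega>" "\<Omega> \<noteq> {}"
  obtains x where "x \<in> mesh_nodes \<T>" "x \<notin> \<Omega>"
proof -
  have "compact (closure \<Omega>)" "closure \<Omega> \<noteq> {}"
    using assms by (auto simp: compact_closure)
  then obtain x where x: "x \<in> closure \<Omega>" "\<And>y. y \<in> closure \<Omega> \<Longrightarrow> norm y \<le> norm x"
    using distance_attains_sup[of "closure \<Omega>" 0] by auto
  have un: "\<Union>\<T> = closure \<Omega>"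
    using mesh by (simp add: tetrahedral_mesh_def)
  with x obtain K where K: "K \<in> \<T>" "x \<in> K"
    by auto
  have "x extreme_point_of K"
    using K un x(2) by (intro farthest_point_extreme) auto
  then have "x \<in> mesh_nodes \<T>"
    using K by (auto simp: mesh_nodes_def vertices_def)
  moreover have "x \<notin> \<Omega>"
    using x(2) closure_subset \<open>open \<Omega>\<close> by (metis open_contains_farther_point in_mono not_less)
  ultimately show ?thesis
    using that by blast
qed

text \<open>Otherwise the elements meeting \<open>N\<close> and those not meeting \<open>N\<close> would split the connected set
  \<open>closure \<Omega>\<close>: two intersecting elements share a face, hence a vertex.\<close>

lemma mesh_element_leaving:
  assumes mesh: "tetrahedral_mesh \<Omega> \<T>" and "open \<Omega>" "connected \<Omega>" "bounded \<Omega>" "\<Omega> \<noteq> {}"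
    and N: "N \<subseteq> mesh_nodes \<T> \<inter> \<Omega>" "N \<noteq> {}"
  shows "\<exists>K\<in>\<T>. vertices K \<inter> N \<noteq> {} \<and> \<not> vertices K \<subseteq> N"
proof (rule ccontr)
  assume "\<not> ?thesis"
  then have closed_N: "vertices K \<subseteq> N" if "K \<in> \<T>" "vertices K \<inter> N \<noteq> {}" for K
    using that by auto
  have un: "\<Union>\<T> = closure \<Omega>" and tri: "triangulation \<T>" and simp: "\<And>K. K \<in> \<T> \<Longrightarrow> 3 simplex K"
    using mesh by (auto simp: tetrahedral_mesh_def)
  define U where "U = {K\<in>\<T>. vertices K \<inter> N \<noteq> {}}"
  define W where "W = {K\<in>\<T>. vertices K \<inter> N = {}}"
  have fin: "finite \<T>"
    using tri by (simp add: triangulation_def)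
  have cl: "closed K" "compact K" "convex K" if "K \<in> \<T>" for K
    using simp[OF that] closed_simplex compact_simplex convex_simplex by auto
  have "closed (\<Union>U)" "closed (\<Union>W)"
    using fin cl by (auto simp: U_def W_def)
  moreover have "\<Union>U \<union> \<Union>W = closure \<Omega>"
    unfolding un[symmetric] U_def W_def by blast
  moreover have "\<Union>U \<inter> \<Union>W = {}"
  proof (rule ccontr)
    assume "\<Union>U \<inter> \<Union>W \<noteq> {}"
    then obtain K L where KL: "K \<in> U" "L \<in> W" "K \<inter> L \<noteq> {}"
      by blast
    then have KL': "K \<in> \<T>" "L \<in> \<T>"
      by (auto simp: U_def W_def)
    then have "K \<inter> L face_of K" "K \<inter> L face_of L"
      using tri by (auto simp: triangulation_def) (metis Int_commute)
    \<comment> \<open>The nonempty compact convex intersection has an extreme point; being a face of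
      both elements, it passes this point on as a common vertex.\<close>
    moreover obtain v where "v extreme_point_of (K \<inter> L)"
      using extreme_point_exists_convex[OF compact_Int convex_Int KL(3)] cl KL' by metis
    ultimately have "v extreme_point_of K" "v extreme_point_of L"
      using extreme_point_of_face by blast+
    then have "v \<in> vertices K" "v \<in> vertices L"
      by (auto simp: vertices_def)
    with closed_N[of K] KL show False
      by (auto simp: U_def W_def)
  qed
  moreover have "connected (closure \<Omega>)"
    using \<open>connected \<Omega>\<close> by (rule connected_imp_connected_closure)
  ultimately have "\<Union>U = {} \<or> \<Union>W = {}"
    unfolding connected_closed_set[OF closed_closure] by metis
  moreover obtain y L where "y \<in> N" "L \<in> \<T>" "y \<in> vertices L"
    using N unfolding mesh_nodes_def by blast
  then have "L \<in> U" "y \<in> L"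
    using vertices_subset by (auto simp: U_def)
  then have "\<Union>U \<noteq> {}"
    by auto
  moreover obtain x K where "x \<notin> \<Omega>" "K \<in> \<T>" "x \<in> vertices K"
    using mesh_node_not_interior[OF mesh \<open>open \<Omega>\<close> \<open>bounded \<Omega>\<close> \<open>\<Omega> \<noteq> {}\<close>]
    unfolding mesh_nodes_def by blast
  \<comment> \<open>A vertex outside \<Omega> is not in \<open>N\<close>, so by
    \<open>closed_N\<close> its element cannot meet \<open>N\<close>.\<close>
  then have "K \<in> W" "x \<in> K"
    using closed_N[of K] N vertices_subset unfolding W_def by blast+
  then have "\<Union>W \<noteq> {}"
    by auto
  ultimately show False
    by blast
qed


section \<open>The EAFE matrix\<close>

text \<open>On the compact parameter interval the integrand attains a positive minimum, and the
  integral is at least this minimum times the edge length.\<close>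

lemma edge_integral_pos:
  assumes "a \<noteq> b" and cont: "continuous_on (closed_segment a b) g"
    and pos: "\<And>y. y \<in> closed_segment a b \<Longrightarrow> 0 < g y"
  shows "0 < edge_integral g a b"
proof -
  let ?h = "\<lambda>s. g (a + (s / dist a b) *\<^sub>R (b - a))"
  have d: "0 < dist a b"
    using \<open>a \<noteq> b\<close> by simp
  have seg: "a + (s / dist a b) *\<^sub>R (b - a) \<in> closed_segment a b" if "s \<in> {0..dist a b}" for s
    unfolding in_segment using that d
    by (intro exI[of _ "s / dist a b"]) (auto simp: algebra_simps)
  have h: "continuous_on {0..dist a b} ?h"
    using seg by (intro continuous_on_compose2[OF cont] continuous_intros) (use d in auto)
  obtain s where s: "s \<in> {0..dist a b}" "\<And>r. r \<in> {0..dist a b} \<Longrightarrow> ?h s \<le> ?h r"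
    using continuous_attains_inf[OF _ _ h] d by force
  have "0 < dist a b * ?h s"
    using pos[OF seg[OF s(1)]] d by simp
  also have "\<dots> = integral {0..dist a b} (\<lambda>_. ?h s)"
    using d by simp
  also have "\<dots> \<le> integral {0..dist a b} ?h"
    using s h by (intro integral_le integrable_continuous_interval) auto
  finally show ?thesis
    by (simp add: edge_integral_def)
qed

lemma phi_h_continuous:
  assumes "nodal_basis S"
  shows "continuous_on (\<Union>(elems S)) (phi_h S q1 q2 fn P)"
  using assms unfolding phi_h_def nodal_basis_def V_h_def P1_space_def
  by (intro continuous_intros) auto

text \<open>Extends the sign hypothesis, stated for ordered index pairs, to all pairs of distinct
  indices.\<close>

lemma omega_commute: "omega S K \<nu> \<mu> = omega S K \<mu> \<nu>"
  by (simp add: omega_def L2_inner_vec_def inner_commute)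

lemma mass_mat_carrier: "mass_mat S \<in> carrier_mat (n_int S) (n_int S)"
  by (simp add: mass_mat_def mat_diag_def)

lemma eafe_mat_carrier: "eafe_mat S q \<phi> \<in> carrier_mat (n_int S) (n_int S)"
  by (simp add: eafe_mat_def)

text \<open>The discrete potential is abstracted to a function continuous on the mesh, which is
  enough for the exponential edge averages to be positive.\<close>

locale eafe_mesh =
  fixes S :: fe_data and q :: real and \<phi> :: "real^3 \<Rightarrow> real"
  assumes fe: "fe_discretization S"
    and omega: "\<forall>K\<in>elems S. \<forall>\<mu><4. \<forall>\<nu><\<mu>. 0 < omega S K \<nu> \<mu>"
    and cont: "continuous_on (\<Union>(elems S)) \<phi>"
begin

lemma mesh: "tetrahedral_mesh (dom S) (elems S)"
  and dom: "open (dom S)" "connected (dom S)" "dom S \<noteq> {}" "bounded (dom S)"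
  and numbering: "node_numbering S"
  using fe by (auto simp: fe_discretization_def lipschitz_domain_def)

lemma finite_elems: "finite (elems S)"
  using mesh by (auto simp: tetrahedral_mesh_def triangulation_def)

lemma vertices_eq: "K \<in> elems S \<Longrightarrow> vertices K = local_vertex S K ` {..<4}"
  and inj_local_vertex: "K \<in> elems S \<Longrightarrow> inj_on (local_vertex S K) {..<4}"
  using numbering by (auto simp: node_numbering_def bij_betw_def local_vertex_def inj_on_def)

lemma glob_less:
  assumes "K \<in> elems S" and "\<nu> < 4"
  shows "glob S K \<nu> < n_all S"
proof -
  have "glob S K ` {..<4} \<subseteq> {..<n_all S}"
    using numbering assms by (simp add: node_numbering_def)
  with assms show ?thesis
    by blast
qed

lemma omega_pos:
  assumes "K \<in> elems S" "\<nu> < 4" "\<mu> < 4" "\<nu> \<noteq> \<mu>"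
  shows "0 < omega S K \<nu> \<mu>"
  using assms omega omega_commute by (metis nat_neq_iff)

text \<open>Convexity keeps the edge inside \<open>K\<close>, where \<phi> is continuous, and
  distinct vertices give it positive length.\<close>

lemma eafe_alpha_pos:
  assumes K: "K \<in> elems S" and "\<nu> < 4" "\<mu> < 4" "\<nu> \<noteq> \<mu>"
  shows "0 < eafe_alpha S q \<phi> K \<nu> \<mu>"
proof -
  let ?a = "local_vertex S K \<nu>" and ?b = "local_vertex S K \<mu>"
  have ab: "?a \<noteq> ?b"
    using inj_local_vertex[OF K] assms by (auto simp: inj_on_def)
  have "?a \<in> K" "?b \<in> K"
    using vertices_eq[OF K] assms by (auto simp: vertices_def extreme_point_of_def)
  moreover have "convex K"
    using mesh K by (auto simp: tetrahedral_mesh_def intro: convex_simplex)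
  ultimately have "closed_segment ?a ?b \<subseteq> \<Union>(elems S)"
    using K closed_segment_subset by blast
  then have "0 < edge_integral (\<lambda>y. exp (q * \<phi> y)) ?a ?b"
    using ab cont by (intro edge_integral_pos continuous_intros) (auto intro: continuous_on_subset)
  with ab show ?thesis
    by (simp add: eafe_alpha_def Let_def)
qed

section \<open>Signs and column sums of the element matrices\<close>

lemma eafe_elem_offdiag_neg:
  assumes "K \<in> elems S" "\<nu> < 4" "\<mu> < 4" "\<nu> \<noteq> \<mu>"
  shows "eafe_elem_mat S q \<phi> K $$ (\<nu>, \<mu>) < 0"
  using assms omega_pos[OF assms] eafe_alpha_pos[OF assms] by (simp add: eafe_elem_mat_def)

lemma eafe_elem_column_sum:
  assumes "\<mu> < 4"
  shows "(\<Sum>\<nu><4. eafe_elem_mat S q \<phi> K $$ (\<nu>, \<mu>)) = 0"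
proof -
  have "(\<Sum>\<nu><4. eafe_elem_mat S q \<phi> K $$ (\<nu>, \<mu>)) =
      eafe_elem_mat S q \<phi> K $$ (\<mu>, \<mu>) + (\<Sum>\<nu>\<in>{..<4} - {\<mu>}. eafe_elem_mat S q \<phi> K $$ (\<nu>, \<mu>))"
    using assms by (simp add: sum.remove)
  then show ?thesis
    using assms by (simp add: eafe_elem_mat_def sum_negf)
qed

text \<open>The contribution of \<open>K\<close> to a global column sum over the rows in
  \<open>J\<close>. For interior \<open>J\<close>, boundary vertices count as outside, which is how
  the Dirichlet condition enters.\<close>

definition partial_column_sum :: "nat set \<Rightarrow> (real^3) set \<Rightarrow> nat \<Rightarrow> real" where
  "partial_column_sum J K \<mu> =
    (\<Sum>\<nu><4. if glob S K \<nu> \<in> J then eafe_elem_mat S q \<phi> K $$ (\<nu>, \<mu>) else 0)"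

text \<open>Since the full column sums vanish, the entries outside \<open>J\<close> account for the sum over \<open>J\<close>.\<close>

lemma partial_column_sum_eq:
  assumes "\<mu> < 4"
  shows "partial_column_sum J K \<mu> =
    (\<Sum>\<nu>\<in>{\<nu>. \<nu> < 4 \<and> glob S K \<nu> \<notin> J}. - eafe_elem_mat S q \<phi> K $$ (\<nu>, \<mu>))"
proof -
  let ?a = "\<lambda>\<nu>. eafe_elem_mat S q \<phi> K $$ (\<nu>, \<mu>)"
  have "(\<Sum>\<nu><4. ?a \<nu>) = partial_column_sum J K \<mu> + (\<Sum>\<nu><4. if glob S K \<nu> \<notin> J then ?a \<nu> else 0)"
    unfolding partial_column_sum_def sum.distrib[symmetric] by (intro sum.cong) auto
  also have "(\<Sum>\<nu><4. if glob S K \<nu> \<notin> J then ?a \<nu> else 0) = (\<Sum>\<nu>\<in>{\<nu>. \<nu> < 4 \<and> glob S K \<nu> \<notin> J}. ?a \<nu>)"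
    by (intro sum.mono_neutral_cong_right) auto
  finally show ?thesis
    using eafe_elem_column_sum[OF assms] by (simp add: sum_negf)
qed

text \<open>A local vertex outside \<open>J\<close> differs from \<mu>, so only negative
  off-diagonal entries occur, with reversed sign.\<close>

lemma partial_column_sum_nonneg:
  assumes "K \<in> elems S" and "\<mu> < 4" and "glob S K \<mu> \<in> J"
  shows "0 \<le> partial_column_sum J K \<mu>"
proof -
  have "0 \<le> - eafe_elem_mat S q \<phi> K $$ (\<nu>, \<mu>)" if "\<nu> < 4" "glob S K \<nu> \<notin> J" for \<nu>
    using eafe_elem_offdiag_neg[of K \<nu> \<mu>] that assms by force
  then show ?thesis
    unfolding partial_column_sum_eq[OF assms(2)] by (intro sum_nonneg) auto
qed

lemma partial_column_sum_pos:
  assumes "K \<in> elems S" and "\<mu> < 4" and "glob S K \<mu> \<in> J" and "\<nu> < 4" "glob S K \<nu> \<notin> J"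
  shows "0 < partial_column_sum J K \<mu>"
proof -
  have "0 < - eafe_elem_mat S q \<phi> K $$ (\<kappa>, \<mu>)" if "\<kappa> < 4" "glob S K \<kappa> \<notin> J" for \<kappa>
    using eafe_elem_offdiag_neg[of K \<kappa> \<mu>] that assms by force
  then show ?thesis
    unfolding partial_column_sum_eq[OF assms(2)] using assms(4,5) by (intro sum_pos) auto
qed

section \<open>Column sums of the assembled matrix\<close>

lemma eafe_mat_column_sum:
  assumes "J \<subseteq> {..<n_int S}" and "j < n_int S"
  shows "(\<Sum>i\<in>J. eafe_mat S q \<phi> $$ (i, j)) =
    (\<Sum>K\<in>elems S. \<Sum>\<mu><4. if glob S K \<mu> = j then partial_column_sum J K \<mu> else 0)"
proof -
  let ?e = "\<lambda>i K \<nu> \<mu>. if glob S K \<nu> = i \<and> glob S K \<mu> = j then eafe_elem_mat S q \<phi> K $$ (\<nu>, \<mu>) else 0"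
  have fin: "finite J"
    using assms finite_subset by blast
  have "(\<Sum>i\<in>J. eafe_mat S q \<phi> $$ (i, j)) = (\<Sum>i\<in>J. \<Sum>K\<in>elems S. \<Sum>\<nu><4. \<Sum>\<mu><4. ?e i K \<nu> \<mu>)"
    using assms by (intro sum.cong) (auto simp: eafe_mat_def)
  also have "\<dots> = (\<Sum>K\<in>elems S. \<Sum>i\<in>J. \<Sum>\<mu><4. \<Sum>\<nu><4. ?e i K \<nu> \<mu>)"
    by (subst sum.swap) (intro sum.cong refl sum.swap)
  also have "\<dots> = (\<Sum>K\<in>elems S. \<Sum>\<mu><4. \<Sum>i\<in>J. \<Sum>\<nu><4. ?e i K \<nu> \<mu>)"
    by (intro sum.cong refl sum.swap)
  also have "\<dots> = (\<Sum>K\<in>elems S. \<Sum>\<mu><4. \<Sum>\<nu><4. \<Sum>i\<in>J. ?e i K \<nu> \<mu>)"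
    by (intro sum.cong refl sum.swap)
  \<comment> \<open>With the rows innermost, the sum over \<open>J\<close> collapses to the test
    whether \<open>glob S K \<nu>\<close> lies in \<open>J\<close>.\<close>
  also have "\<dots> = (\<Sum>K\<in>elems S. \<Sum>\<mu><4. if glob S K \<mu> = j then partial_column_sum J K \<mu> else 0)"
    using fin unfolding partial_column_sum_def by (intro sum.cong refl) (auto simp: sum.delta)
  finally show ?thesis .
qed

lemma eafe_mat_column_sum_nonneg:
  assumes "J \<subseteq> {..<n_int S}" and "j \<in> J"
  shows "0 \<le> (\<Sum>i\<in>J. eafe_mat S q \<phi> $$ (i, j))"
proof -
  have "j < n_int S"
    using assms by auto
  then show ?thesis
    using assms partial_column_sum_nonneg by (auto simp: eafe_mat_column_sum intro!: sum_nonneg)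
qed

text \<open>One element with a vertex outside \<open>J\<close> contributes a positive term, and no
  other contribution is negative.\<close>

lemma eafe_mat_column_sum_pos:
  assumes J: "J \<subseteq> {..<n_int S}" and K: "K \<in> elems S" and \<mu>: "\<mu> < 4" "glob S K \<mu> \<in> J"
    and \<nu>: "\<nu> < 4" "glob S K \<nu> \<notin> J"
  shows "0 < (\<Sum>i\<in>J. eafe_mat S q \<phi> $$ (i, glob S K \<mu>))"
proof -
  let ?s = "\<lambda>L \<kappa>. if glob S L \<kappa> = glob S K \<mu> then partial_column_sum J L \<kappa> else 0"
  have nonneg: "0 \<le> ?s L \<kappa>" if "L \<in> elems S" "\<kappa> < 4" for L \<kappa>
    using that \<mu> partial_column_sum_nonneg by auto
  have "0 < (\<Sum>\<kappa><4. ?s K \<kappa>)"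
    using \<mu> nonneg K partial_column_sum_pos[OF K \<mu> \<nu>] by (intro sum_pos2[of _ \<mu>]) auto
  then have "0 < (\<Sum>L\<in>elems S. \<Sum>\<kappa><4. ?s L \<kappa>)"
    using finite_elems K nonneg by (intro sum_pos2[of _ K] sum_nonneg) auto
  moreover have "glob S K \<mu> < n_int S"
    using J \<mu> by auto
  ultimately show ?thesis
    using J by (simp add: eafe_mat_column_sum)
qed

section \<open>From mesh connectivity to the M-matrix property\<close>

lemma element_leaving:
  assumes J: "J \<subseteq> {..<n_int S}" "J \<noteq> {}"
  obtains K \<mu> \<nu> where "K \<in> elems S" "\<mu> < 4" "glob S K \<mu> \<in> J" "\<nu> < 4" "glob S K \<nu> \<notin> J"
proof -
  have inj: "inj_on (node S) {..<n_all S}" and le: "n_int S \<le> n_all S"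
    and int: "node S ` {..<n_int S} = mesh_nodes (elems S) \<inter> dom S"
    using numbering by (auto simp: node_numbering_def bij_betw_def)
  \<comment> \<open>Injectivity on all node numbers, boundary ones included, translates between
    points and indices.\<close>
  have mem: "local_vertex S K \<nu> \<in> node S ` J \<longleftrightarrow> glob S K \<nu> \<in> J" if "K \<in> elems S" "\<nu> < 4" for K \<nu>
    unfolding local_vertex_def using glob_less[OF that] J le
    by (intro inj_on_image_mem_iff[OF inj]) auto
  have "node S ` J \<subseteq> mesh_nodes (elems S) \<inter> dom S"
    using J int by blast
  then obtain K where K: "K \<in> elems S" "vertices K \<inter> node S ` J \<noteq> {}" "\<not> vertices K \<subseteq> node S ` J"
    using mesh_element_leaving[OF mesh dom(1,2,4,3), of "node S ` J"] J by auto
  from K(2,3) obtain \<mu> \<nu> where "\<mu> < 4" "local_vertex S K \<mu> \<in> node S ` J"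
    "\<nu> < 4" "local_vertex S K \<nu> \<notin> node S ` J"
    unfolding vertices_eq[OF K(1)] by blast
  with K(1) mem show ?thesis
    using that by blast
qed

text \<open>A nonnegative diagonal matrix leaves the off-diagonal signs alone and can only raise
  column sums. Taking \<open>D\<close> as zero or as the mass matrix covers both claims of the
  theorem.\<close>

lemma column_M_matrix_add_eafe:
  assumes D: "D \<in> carrier_mat (n_int S) (n_int S)"
    and off: "\<And>i j. i < n_int S \<Longrightarrow> j < n_int S \<Longrightarrow> i \<noteq> j \<Longrightarrow> D $$ (i, j) = 0"
    and diag: "\<And>i. i < n_int S \<Longrightarrow> 0 \<le> D $$ (i, i)"
    and "0 < \<tau>"
  shows "column_M_matrix (D + \<tau> \<cdot>\<^sub>m eafe_mat S q \<phi>)"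
proof (rule column_M_matrixI)
  let ?n = "n_int S" and ?E = "eafe_mat S q \<phi>"
  note E = eafe_mat_carrier[of S q \<phi>]
  show "D + \<tau> \<cdot>\<^sub>m ?E \<in> carrier_mat ?n ?n"
    using D E by auto
  have D_nonneg: "0 \<le> D $$ (i, j)" if "i < ?n" "j < ?n" for i j
    using off[OF that] diag[OF that(1)] by (cases "i = j") auto
  have entry: "(D + \<tau> \<cdot>\<^sub>m ?E) $$ (i, j) = D $$ (i, j) + \<tau> * ?E $$ (i, j)" if "i < ?n" "j < ?n" for i j
    using that D E by auto
  have sum: "\<tau> * (\<Sum>i\<in>J. ?E $$ (i, j)) \<le> (\<Sum>i\<in>J. (D + \<tau> \<cdot>\<^sub>m ?E) $$ (i, j))"
    if "J \<subseteq> {..<?n}" "j < ?n" for J j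
    unfolding sum_distrib_left using that D_nonneg by (intro sum_mono) (subst entry, auto)
  show "(D + \<tau> \<cdot>\<^sub>m ?E) $$ (i, j) \<le> 0" if "i < ?n" "j < ?n" "i \<noteq> j" for i j
  proof -
    \<comment> \<open>Distinct global numbers come from distinct local ones, so only off-diagonal
      element entries are assembled here.\<close>
    have "?E $$ (i, j) \<le> 0"
      using that by (auto simp: eafe_mat_def intro!: sum_nonpos less_imp_le[OF eafe_elem_offdiag_neg])
    then show ?thesis
      using that \<open>0 < \<tau>\<close> off by (simp add: entry mult_nonneg_nonpos)
  qed
  show "0 \<le> (\<Sum>i<?n. (D + \<tau> \<cdot>\<^sub>m ?E) $$ (i, j))" if "j < ?n" for j
    using sum[of "{..<?n}" j] eafe_mat_column_sum_nonneg[of "{..<?n}" j] that \<open>0 < \<tau>\<close>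
    by (meson lessThan_iff less_imp_le mult_nonneg_nonneg order_refl order_trans)
  show "\<exists>j\<in>J. 0 < (\<Sum>i\<in>J. (D + \<tau> \<cdot>\<^sub>m ?E) $$ (i, j))" if J: "J \<subseteq> {..<?n}" "J \<noteq> {}" for J
  proof -
    obtain K \<mu> \<nu> where K: "K \<in> elems S" "\<mu> < 4" "glob S K \<mu> \<in> J" "\<nu> < 4" "glob S K \<nu> \<notin> J"
      using element_leaving[OF J] .
    have "0 < \<tau> * (\<Sum>i\<in>J. ?E $$ (i, glob S K \<mu>))"
      using eafe_mat_column_sum_pos[OF J(1) K] \<open>0 < \<tau>\<close> by simp
    also have "\<dots> \<le> (\<Sum>i\<in>J. (D + \<tau> \<cdot>\<^sub>m ?E) $$ (i, glob S K \<mu>))"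
      using J K by (intro sum) auto
    finally show ?thesis
      using K by blast
  qed
qed

lemma column_M_matrix_eafe: "column_M_matrix (eafe_mat S q \<phi>)"
proof -
  have "0\<^sub>m (n_int S) (n_int S) + 1 \<cdot>\<^sub>m eafe_mat S q \<phi> = eafe_mat S q \<phi>"
    by (intro eq_matI) (auto simp: eafe_mat_def)
  then show ?thesis
    using column_M_matrix_add_eafe[of "0\<^sub>m (n_int S) (n_int S)" 1] by simp
qed

lemma column_M_matrix_mass_add_eafe:
  assumes "0 < \<tau>"
  shows "column_M_matrix (mass_mat S + \<tau> \<cdot>\<^sub>m eafe_mat S q \<phi>)"
  using assms by (intro column_M_matrix_add_eafe) (auto simp: mass_mat_def mat_diag_def support_volume_def)

end

theorem lemma3p1:
  fixes S :: fe_data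
    and q1 q2 \<tau> T :: real
    and t :: "nat \<Rightarrow> real"
    and N n :: nat
    and f :: "real \<Rightarrow> real^3 \<Rightarrow> real"
    and P :: "real vec"
  assumes "fe_discretization S"
    and "strict_mono_on {0..N} t" and "t N = T"
    and "n < N"
    and "0 < \<tau>" and "\<tau> = t (Suc n) - t n"
    and "\<forall>K\<in>elems S. \<forall>\<mu><4. \<forall>\<nu><\<mu>. 0 < omega S K \<nu> \<mu>"
    and "P \<in> carrier_vec (2 * n_int S)"
  shows "column_M_matrix (A_tilde S q1 q2 (f (t (Suc n))) P) \<and>
         column_M_matrix (A_mat S q1 q2 \<tau> (f (t (Suc n))) P)"
proof -
  let ?\<phi> = "phi_h S q1 q2 (f (t (Suc n))) P"
  have "eafe_mesh S ?\<phi>"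
    using assms(1,7) by (intro eafe_mesh.intro phi_h_continuous) (auto simp: fe_discretization_def)
  \<comment> \<open>Leaving \<open>q\<close> open makes one interpretation serve both
    charges.\<close>
  then interpret eafe_mesh S q ?\<phi> for q .
  show ?thesis
    unfolding A_mat_def block_mass_mat_def A_tilde_def
      diag_block_mat_add_smult[OF mass_mat_carrier mass_mat_carrier eafe_mat_carrier eafe_mat_carrier]
    using column_M_matrix_eafe column_M_matrix_mass_add_eafe[OF \<open>0 < \<tau>\<close>]
    by (intro conjI column_M_matrix_diag_block) simp_all
qed

end
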